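(* Let $(T_1,T_2)$ be a pair of doubly commuting operators on a complex Hilbert space $\mathcal{H}$. Then the map $T:\mathbb{Z}\oplus\mathbb{Z}\to\mathcal{B}(\mathcal{H})$ given by $$T(m,n)=\begin{cases} T_1^mT_2^n & m\ge 0,\ n\ge 0\\ T_1^{*|m|}T_2^n & m<0,\ n\ge 0\\ T_2^{*|n|}T_1^m & m\ge 0,\ n<0\\ T_1^{*|m|}T_2^{*|n|} & m<0,\ n<0\end{cases}$$ is positive definite if and only if $T_1$ and $T_2$ are contractions.
   Context: All operators are bounded and linear; $\mathcal{B}(\mathcal{H})$ is the algebra of bounded operators on $\mathcal{H}$. $(T_1,T_2)$ is doubly commuting if $T_1T_2=T_2T_1$ and $T_1^*T_2=T_2T_1^*$. A contraction is an operator of norm at most one. Zeroth powers are the identity. For a group $G$, a map $T:G\to\mathcal{B}(\mathcal{H})$ is positive definite if $T(s^{-1})=T(s)^*$ for every $s\in G$ and $\sum_{s\in G}\sum_{t\in G}\langle T(t^{-1}s)h(s),h(t)\rangle\ge 0$ for every finitely supported function $h:G\to\mathcal{H}$. *)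

theory Defs
  imports "HOL-Analysis.Analysis"
begin

text \<open>
  A complex inner product space is set up on top of the library class of real inner product
  spaces, whose structure is tied to the complex one by \<open>scaleR_scaleC\<close> and \<open>inner_Re_cinner\<close>;
  in particular the norm and topology are those of \<open>cinner\<close>.  The inner product is linear in
  its first argument.
\<close>

class complex_inner = real_inner +
  fixes scaleC :: "complex \<Rightarrow> 'a \<Rightarrow> 'a"  (infixr \<open>*\<^sub>C\<close> 75)
    and cinner :: "'a \<Rightarrow> 'a \<Rightarrow> complex"
  assumes scaleC_add_right: "c *\<^sub>C (x + y) = c *\<^sub>C x + c *\<^sub>C y"
    and scaleC_add_left: "(c + d) *\<^sub>C x = c *\<^sub>C x + d *\<^sub>C x"
    and scaleC_scaleC: "c *\<^sub>C d *\<^sub>C x = (c * d) *\<^sub>C x"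
    and scaleR_scaleC: "r *\<^sub>R x = complex_of_real r *\<^sub>C x"
    and cinner_commute: "cinner x y = cnj (cinner y x)"
    and cinner_add_left: "cinner (x + y) z = cinner x z + cinner y z"
    and cinner_scaleC_left: "cinner (c *\<^sub>C x) y = c * cinner x y"
    and inner_Re_cinner: "inner x y = Re (cinner x y)"

class chilbert_space = complex_inner + complete_space

instantiation complex :: chilbert_space
begin

definition scaleC_complex :: "complex \<Rightarrow> complex \<Rightarrow> complex" where
  "scaleC_complex c x = c * x"

definition cinner_complex :: "complex \<Rightarrow> complex \<Rightarrow> complex" where
  "cinner_complex x y = x * cnj y"

instance
  by standard
    (auto simp: scaleC_complex_def cinner_complex_def inner_complex_def scaleR_conv_of_real
      algebra_simps)

end

definition bounded_clinear :: "('a::complex_inner \<Rightarrow> 'b::complex_inner) \<Rightarrow> bool" where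
  "bounded_clinear f \<longleftrightarrow> bounded_linear f \<and> (\<forall>c x. f (c *\<^sub>C x) = c *\<^sub>C f x)"

typedef (overloaded) 'a bop = "{f :: 'a::complex_inner \<Rightarrow> 'a. bounded_clinear f}"
  morphisms bop_apply Bop
proof
  show "(\<lambda>x. x) \<in> {f :: 'a \<Rightarrow> 'a. bounded_clinear f}"
    by (simp add: bounded_clinear_def bounded_linear_ident)
qed

setup_lifting type_definition_bop

instantiation bop :: (complex_inner) monoid_mult
begin

lift_definition one_bop :: "'a bop" is "\<lambda>x. x"
  by (simp add: bounded_clinear_def bounded_linear_ident)

lift_definition times_bop :: "'a bop \<Rightarrow> 'a bop \<Rightarrow> 'a bop" is "\<lambda>S T x. S (T x)"
  by (simp add: bounded_clinear_def bounded_linear_compose)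

instance
  by standard (transfer; simp)+

end

definition adj :: "'a::chilbert_space bop \<Rightarrow> 'a bop" where
  "adj T = (THE S. \<forall>x y. cinner (bop_apply T x) y = cinner x (bop_apply S y))"

text \<open>
  Existence of adjoints, so that the description in \<open>adj_def\<close> is proper: the Riesz
  representation theorem is obtained by minimising \<open>\<parallel>x\<parallel>\<^sup>2 - 2 f x\<close>.
\<close>

lemma riesz_representation:
  fixes f :: "'a::{real_inner,complete_space} \<Rightarrow> real"
  assumes "bounded_linear f"
  shows "\<exists>z. \<forall>x. f x = inner z x"
proof -
  interpret f: bounded_linear f by fact
  define J where "J x = (norm x)\<^sup>2 - 2 * f x" for x
  obtain K where K: "norm (f x) \<le> norm x * K" for x
    using f.bounded by blast
  have lower: "- K\<^sup>2 \<le> J x" for x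
  proof -
    have "f x \<le> norm x * K" using K[of x] by simp
    moreover have "0 \<le> (norm x - K)\<^sup>2" by simp
    ultimately show ?thesis by (simp add: J_def power2_diff)
  qed
  define d where "d = Inf (range J)"
  have bdd: "bdd_below (range J)" using lower by (auto intro!: bdd_belowI)
  have d_le: "d \<le> J x" for x
    unfolding d_def by (rule cInf_lower) (use bdd in auto)
  have "\<exists>x. J x < d + 1 / Suc n" for n
    using cInf_lessD[of "range J" "d + 1 / Suc n"] by (auto simp: d_def)
  then obtain u where u: "J (u n) < d + 1 / Suc n" for n by metis
  have par: "J x + J y - 2 * J ((1/2) *\<^sub>R (x + y)) = (norm (x - y))\<^sup>2 / 2" for x y
    by (simp add: J_def f.scaleR f.add power2_norm_eq_inner inner_add_left inner_add_right
        inner_diff_left inner_diff_right inner_commute field_simps)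
  have dist: "(norm (u m - u n))\<^sup>2 \<le> 2 * (1 / Suc m + 1 / Suc n)" for m n
    using par[of "u m" "u n"] u[of m] u[of n] d_le[of "(1/2) *\<^sub>R (u m + u n)"] by simp
  have "Cauchy u"
  proof (rule metric_CauchyI)
    fix e :: real assume "0 < e"
    then obtain N where N: "1 / Suc N < e\<^sup>2 / 4"
      using nat_approx_posE[of "e\<^sup>2 / 4"] by (metis divide_pos_pos zero_less_numeral zero_less_power)
    have "dist (u m) (u n) < e" if "m \<ge> N" "n \<ge> N" for m n
    proof -
      have le: "1 / real (Suc m) \<le> 1 / real (Suc N)" "1 / real (Suc n) \<le> 1 / real (Suc N)"
        using that by (auto intro!: divide_left_mono)
      have "x < e\<^sup>2" if "x \<le> 2 * (a + b)" "c < e\<^sup>2 / 4" "a \<le> c" "b \<le> c" for x a b c :: real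
        using that by (simp add: field_simps)
      from this[OF dist[of m n] N le] have "(norm (u m - u n))\<^sup>2 < e\<^sup>2" .
      then show ?thesis
        using \<open>0 < e\<close> by (simp add: dist_norm power_less_imp_less_base)
    qed
    then show "\<exists>M. \<forall>m\<ge>M. \<forall>n\<ge>M. dist (u m) (u n) < e" by blast
  qed
  then obtain z where z: "u \<longlonglongrightarrow> z"
    using Cauchy_convergent_iff convergent_def by blast
  have "(\<lambda>n. J (u n)) \<longlonglongrightarrow> J z"
    unfolding J_def by (intro tendsto_intros z f.tendsto)
  moreover have "(\<lambda>n. d + 1 / Suc n) \<longlonglongrightarrow> d + 0"
    by (intro tendsto_intros LIMSEQ_Suc[OF lim_1_over_n])
  ultimately have "J z \<le> d"
    using LIMSEQ_le[of "\<lambda>n. J (u n)" "J z" "\<lambda>n. d + 1 / Suc n" "d + 0"] u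
    by (metis add_0_right less_imp_le)
  then have min: "J z \<le> J x" for x using d_le[of x] by simp
  have "f x = inner z x" for x
  proof (cases "x = 0")
    case True
    then show ?thesis by (simp add: f.zero)
  next
    case False
    define a where "a = inner z x - f x"
    define t where "t = - a / inner x x"
    have pos: "inner x x > 0" using False by simp
    have "J (z + t *\<^sub>R x) = J z + 2 * t * a + t\<^sup>2 * inner x x"
      unfolding J_def power2_norm_eq_inner
      by (simp add: a_def f.add f.scaleR inner_add_left inner_add_right
          inner_commute algebra_simps power2_eq_square)
    also have "\<dots> = J z - a\<^sup>2 / inner x x"
      using pos by (simp add: t_def power2_eq_square field_simps)
    finally have "a\<^sup>2 / inner x x \<le> 0" using min[of "z + t *\<^sub>R x"] by simp
    with pos have "a = 0" by (auto simp: divide_le_0_iff simp del: inner_gt_zero_iff)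
    then show ?thesis by (simp add: a_def)
  qed
  then show ?thesis by blast
qed

lemma cinner_Im: "Im (cinner x y) = inner x (\<i> *\<^sub>C y)"
proof -
  have "cinner x (\<i> *\<^sub>C y) = - \<i> * cinner x y"
    by (subst cinner_commute, subst cinner_scaleC_left, subst (2) cinner_commute) simp
  then show ?thesis by (simp add: inner_Re_cinner)
qed

lemma ex_bop_adjoint:
  fixes T :: "'a::chilbert_space bop"
  shows "\<exists>!S. \<forall>x y. cinner (bop_apply T x) y = cinner x (bop_apply S y)"
proof -
  have T: "bounded_linear (bop_apply T)" "\<And>c x. bop_apply T (c *\<^sub>C x) = c *\<^sub>C bop_apply T x"
    using bop_apply[of T] by (auto simp: bounded_clinear_def)
  interpret T: bounded_linear "bop_apply T" by (rule T)
  have "\<exists>z. \<forall>x. inner (bop_apply T x) y = inner z x" for y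
    by (rule riesz_representation)
      (rule bounded_linear_compose[OF bounded_linear_inner_left T(1)])
  then obtain S where S: "inner (bop_apply T x) y = inner x (S y)" for x y
    by (metis inner_commute)
  have eqI: "v = w" if "\<And>x. inner x v = inner x w" for v w :: 'a
    using that[of "v - w"] by (metis inner_diff_right inner_eq_zero_iff right_minus_eq)
  have adjC: "inner (c *\<^sub>C x) y = inner x (cnj c *\<^sub>C y)" for c and x y :: 'a
  proof -
    have "cinner x (cnj c *\<^sub>C y) = c * cinner x y"
      by (subst cinner_commute, subst cinner_scaleC_left, subst (2) cinner_commute) simp
    then show ?thesis by (simp add: inner_Re_cinner cinner_scaleC_left)
  qed
  have SC: "S (c *\<^sub>C y) = c *\<^sub>C S y" for c y
  proof (rule eqI)
    fix x
    show "inner x (S (c *\<^sub>C y)) = inner x (c *\<^sub>C S y)"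
      using adjC[of "cnj c" "bop_apply T x" y] adjC[of "cnj c" x "S y"]
      by (simp flip: S add: T(2))
  qed
  obtain K where K: "norm (bop_apply T x) \<le> norm x * K" for x
    using T.bounded by blast
  have "norm (S y) \<le> norm y * K" for y
  proof (cases "S y = 0")
    case True
    have "0 \<le> norm y * K" using K[of y] norm_ge_zero order_trans by blast
    with True show ?thesis by simp
  next
    case False
    have "norm (S y) * norm (S y) = inner (bop_apply T (S y)) y"
      by (simp add: S power2_norm_eq_inner flip: power2_eq_square)
    also have "\<dots> \<le> norm (bop_apply T (S y)) * norm y" by (rule norm_cauchy_schwarz)
    also have "\<dots> \<le> (norm (S y) * K) * norm y" by (intro mult_right_mono K) simp
    finally show ?thesis using False by (simp add: mult_ac)
  qed
  moreover have "S (x + y) = S x + S y" for x y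
    by (rule eqI) (simp add: inner_add_right flip: S)
  moreover have "S (r *\<^sub>R y) = r *\<^sub>R S y" for r y
    by (simp add: scaleR_scaleC SC)
  ultimately have "bounded_clinear S"
    unfolding bounded_clinear_def by (auto intro!: bounded_linear_intro SC)
  then have S': "bop_apply (Bop S) = S" by (simp add: Bop_inverse)
  have "cinner (bop_apply T x) y = cinner x (S y)" for x y
    by (rule complex_eqI) (simp_all add: S SC cinner_Im flip: inner_Re_cinner)
  then have ex: "\<forall>x y. cinner (bop_apply T x) y = cinner x (bop_apply (Bop S) y)"
    by (simp add: S')
  show ?thesis
  proof (rule ex1I[where a = "Bop S"], rule ex)
    fix R assume R: "\<forall>x y. cinner (bop_apply T x) y = cinner x (bop_apply R y)"
    have "bop_apply R y = bop_apply (Bop S) y" for y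
      by (rule eqI) (metis R ex inner_Re_cinner)
    then show "R = Bop S" by (simp add: bop_apply_inject[symmetric] fun_eq_iff)
  qed
qed

lemma cinner_adj: "cinner (bop_apply T x) y = cinner x (bop_apply (adj T) y)"
  using theI'[OF ex_bop_adjoint[of T]] unfolding adj_def by blast

definition doubly_commuting :: "'a::chilbert_space bop \<Rightarrow> 'a bop \<Rightarrow> bool" where
  "doubly_commuting T1 T2 \<longleftrightarrow> T1 * T2 = T2 * T1 \<and> adj T1 * T2 = T2 * adj T1"

definition contraction :: "'a::chilbert_space bop \<Rightarrow> bool" where
  "contraction T \<longleftrightarrow> onorm (bop_apply T) \<le> 1"

text \<open>
  The group is written additively, so \<open>- t + s\<close> stands for \<open>t\<^sup>-\<^sup>1 s\<close>. The sum is taken over the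
  support of \<open>h\<close>, outside of which all terms vanish; being \<open>\<ge> 0\<close> includes being real.
\<close>

definition positive_definite :: "('g::group_add \<Rightarrow> 'a::chilbert_space bop) \<Rightarrow> bool" where
  "positive_definite T \<longleftrightarrow>
     (\<forall>s. T (- s) = adj (T s)) \<and>
     (\<forall>h. finite {s. h s \<noteq> 0} \<longrightarrow>
        (\<Sum>s | h s \<noteq> 0. \<Sum>t | h t \<noteq> 0. cinner (bop_apply (T (- t + s)) (h s)) (h t)) \<in> \<real>\<^sub>\<ge>\<^sub>0)"

definition pair_map :: "'a::chilbert_space bop \<Rightarrow> 'a bop \<Rightarrow> int \<times> int \<Rightarrow> 'a bop" where
  "pair_map T1 T2 = (\<lambda>(m, n).
     if m \<ge> 0 \<and> n \<ge> 0 then T1 ^ nat m * T2 ^ nat n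
     else if m < 0 \<and> n \<ge> 0 then adj T1 ^ nat \<bar>m\<bar> * T2 ^ nat n
     else if m \<ge> 0 \<and> n < 0 then adj T2 ^ nat \<bar>n\<bar> * T1 ^ nat m
     else adj T1 ^ nat \<bar>m\<bar> * adj T2 ^ nat \<bar>n\<bar>)"

end

theory Submission
  imports Defs "HOL-Library.Function_Algebras"
begin

text \<open>
  After a translation the indices \<open>s\<close>, \<open>t\<close> are natural numbers, and the kernel of one contraction
  is \<open>\<langle>T\<^sup>s\<^sup>-\<^sup>t x\<^sub>s, T\<^sup>t\<^sup>-\<^sup>s x\<^sub>t\<rangle>\<close> with truncated subtraction.  Splitting off the index \<open>0\<close> shows inductively that its
  quadratic form dominates \<open>\<parallel>\<Sum>s. T\<^sup>s x\<^sub>s\<parallel>\<^sup>2\<close>.  This works for every positive semidefinite form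
  contracted by \<open>T\<close>.  For two operators, the argument is applied to \<open>T\<^sub>1\<close> acting on the form
  obtained from \<open>T\<^sub>2\<close>; that \<open>T\<^sub>1\<close> contracts this form reduces, by the same lemma, to
  \<open>\<parallel>x\<parallel>\<^sup>2 - \<parallel>T\<^sub>1 x\<parallel>\<^sup>2 - \<parallel>T\<^sub>2 x\<parallel>\<^sup>2 + \<parallel>T\<^sub>1 T\<^sub>2 x\<parallel>\<^sup>2 \<ge> 0\<close>.  The latter is where double commutativity enters:
  \<open>1 - T\<^sub>1\<^sup>*T\<^sub>1\<close> commutes with \<open>C = T\<^sub>2\<^sup>*T\<^sub>2\<close>, so that \<open>n \<mapsto> \<langle>(1 - T\<^sub>1\<^sup>*T\<^sub>1) C\<^sup>n x, C\<^sup>n x\<rangle>\<close> is a bounded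
  log-convex sequence, hence cannot increase.
\<close>

section \<open>Semidefinite forms and log-convex sequences\<close>

lemma toeplitz_form_nonneg:
  fixes q :: "'v::ab_group_add \<Rightarrow> 'v \<Rightarrow> real" and T :: "'v \<Rightarrow> 'v"
  assumes q_add: "\<And>x y z. q (x + y) z = q x z + q y z"
    and q_sym: "\<And>x y. q x y = q y x"
    and q_pos: "\<And>x. q x x \<ge> 0"
    and T_add: "\<And>x y. T (x + y) = T x + T y"
    and T_le: "\<And>x. q (T x) (T x) \<le> q x x"
  shows "0 \<le> (\<Sum>s<n. \<Sum>t<n. q ((T ^^ (s - t)) (x s)) ((T ^^ (t - s)) (x t)))"
proof -
  have T_0: "T 0 = 0" using T_add[of 0 0] by simp
  have q_0: "q 0 y = 0" for y using q_add[of 0 0 y] by simp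
  have T_sum: "T (sum f A) = (\<Sum>i\<in>A. T (f i))" for f and A :: "nat set"
    by (induction A rule: infinite_finite_induct) (simp_all add: T_0 T_add)
  have q_sum: "q (sum f A) y = (\<Sum>i\<in>A. q (f i) y)" for f y and A :: "nat set"
    by (induction A rule: infinite_finite_induct) (simp_all add: q_0 q_add)
  define w where "w n x = (\<Sum>s<n. (T ^^ s) (x s))" for n and x :: "nat \<Rightarrow> 'v"
  have w_Suc: "w (Suc n) x = x 0 + T (w n (\<lambda>s. x (Suc s)))" for n x
    by (simp add: w_def sum.lessThan_Suc_shift T_sum del: sum.lessThan_Suc)
  have "q (w n x) (w n x) \<le> (\<Sum>s<n. \<Sum>t<n. q ((T ^^ (s - t)) (x s)) ((T ^^ (t - s)) (x t)))"
  proof (induction n arbitrary: x)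
    case 0
    show ?case by (simp add: w_def q_0)
  next
    case (Suc n)
    define y where "y = (\<lambda>s. x (Suc s))"
    define S where "S = (\<Sum>s<n. \<Sum>t<n. q ((T ^^ (s - t)) (y s)) ((T ^^ (t - s)) (y t)))"
    have cross: "(\<Sum>s<n. q ((T ^^ Suc s) (y s)) (x 0)) = q (T (w n y)) (x 0)"
      by (simp add: w_def T_sum q_sum)
    have cross': "(\<Sum>s<n. q (x 0) ((T ^^ Suc s) (y s))) = q (T (w n y)) (x 0)"
      using cross by (simp add: q_sym[of "x 0"])
    \<comment> \<open>Corner, first row and first column are split off. The remaining block depends
      only on differences of indices, so it is the same sum for the shifted family
      \<open>y\<close>.\<close>
    have "(\<Sum>s<Suc n. \<Sum>t<Suc n. q ((T ^^ (s - t)) (x s)) ((T ^^ (t - s)) (x t)))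
        = q (x 0) (x 0) + 2 * q (T (w n y)) (x 0) + S"
      using cross cross'
      by (simp add: sum.lessThan_Suc_shift sum.distrib S_def y_def del: sum.lessThan_Suc funpow.simps)
    moreover have "q (w (Suc n) x) (w (Suc n) x)
        = q (x 0) (x 0) + 2 * q (T (w n y)) (x 0) + q (T (w n y)) (T (w n y))"
    proof -
      have "q (a + b) (a + b) = q a a + 2 * q b a + q b b" for a b
        using q_add[of a b "a + b"] q_add[of a b a] q_add[of a b b]
        by (simp add: q_sym[of a "a + b"] q_sym[of b "a + b"] q_sym[of a b])
      then show ?thesis by (simp only: w_Suc y_def)
    qed
    \<comment> \<open>\<open>T_le\<close> strips the outer \<open>T\<close>; the induction
      hypothesis for \<open>y\<close> then bounds the square by the block.\<close>
    moreover have "q (T (w n y)) (T (w n y)) \<le> S"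
      using T_le[of "w n y"] Suc.IH[of y] by (simp add: S_def)
    ultimately show ?case by simp
  qed
  with q_pos show ?thesis by (meson order_trans)
qed

text \<open>Log-convexity makes the ratios of consecutive terms nondecreasing, so a first ratio
  above 1 forces geometric growth and contradicts the bound.\<close>

lemma bounded_log_convex_le:
  fixes a :: "nat \<Rightarrow> real"
  assumes nonneg: "\<And>n. 0 \<le> a n"
    and log_convex: "\<And>n. (a (Suc n))\<^sup>2 \<le> a n * a (Suc (Suc n))"
    and bounded: "\<And>n. a n \<le> M"
  shows "a 1 \<le> a 0"
proof (rule ccontr)
  assume "\<not> a 1 \<le> a 0"
  then have less: "a 0 < a 1" by simp
  \<comment> \<open>If \<open>a 0\<close> were 0, log-convexity would force
    \<open>a 1 = 0\<close>.\<close>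
  have pos0: "0 < a 0"
    using log_convex[of 0] less nonneg[of 0] by (cases "a 0 = 0") auto
  define r where "r = a 1 / a 0"
  have r: "1 < r" using less pos0 by (simp add: r_def)
  have step: "0 < a n \<and> r * a n \<le> a (Suc n)" for n
  proof (induction n)
    case 0
    show ?case using pos0 by (simp add: r_def)
  next
    case (Suc n)
    then have pos: "0 < a n" and le: "r * a n \<le> a (Suc n)" by auto
    have pos': "0 < a (Suc n)"
      using le r pos by (meson less_le_trans mult_pos_pos zero_less_one order_less_trans)
    have "a n * (r * a (Suc n)) \<le> a (Suc n) * a (Suc n)"
      using mult_right_mono[OF le, of "a (Suc n)"] pos' by (simp add: mult_ac)
    also have "\<dots> \<le> a n * a (Suc (Suc n))"
      using log_convex[of n] by (simp add: power2_eq_square)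
    finally show ?case using pos pos' by simp
  qed
  have "r ^ n * a 0 \<le> a n" for n
  proof (induction n)
    case (Suc n)
    have "r ^ Suc n * a 0 = r * (r ^ n * a 0)" by simp
    also have "\<dots> \<le> r * a n" using Suc r by (intro mult_left_mono) auto
    finally show ?case using step[of n] by simp
  qed simp
  moreover obtain n where "M / a 0 < r ^ n"
    using real_arch_pow[OF r] by blast
  ultimately show False
    using bounded[of n] pos0 by (metis pos_divide_less_eq not_le order_trans)
qed

text \<open>The form may be degenerate: a defect form can vanish on nonzero vectors.\<close>

lemma form_Cauchy_Schwarz:
  fixes q :: "'v::real_vector \<Rightarrow> 'v \<Rightarrow> real"
  assumes q_add: "\<And>x y z. q (x + y) z = q x z + q y z"
    and q_scale: "\<And>r x y. q (r *\<^sub>R x) y = r * q x y"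
    and q_sym: "\<And>x y. q x y = q y x"
    and q_pos: "\<And>x. q x x \<ge> 0"
  shows "(q x y)\<^sup>2 \<le> q x x * q y y"
proof -
  have expand: "q (u *\<^sub>R x + v *\<^sub>R y) (u *\<^sub>R x + v *\<^sub>R y)
      = u\<^sup>2 * q x x + 2 * u * v * q x y + v\<^sup>2 * q y y" for u v
  proof -
    have "q z (u *\<^sub>R x + v *\<^sub>R y) = u * q x z + v * q y z" for z
      by (simp add: q_sym[of z] q_add q_scale)
    then show ?thesis
      by (simp add: q_add q_scale q_sym[of y x] power2_eq_square algebra_simps)
  qed
  show ?thesis
  proof (cases "q y y = 0")
    case True
    \<comment> \<open>With \<open>q y y = 0\<close> the expansion at \<open>u = 1\<close> is affine
      in \<open>v\<close>; for nonzero \<open>q x y\<close> the \<open>v\<close> below gives it the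
      value -1.\<close>
    have "q x y = 0"
    proof (rule ccontr)
      assume "q x y \<noteq> 0"
      then have "q x x + 2 * (- (q x x + 1) / (2 * q x y)) * q x y = - 1"
        by (simp add: field_simps)
      then show False
        using expand[of 1 "- (q x x + 1) / (2 * q x y)"] True
          q_pos[of "1 *\<^sub>R x + (- (q x x + 1) / (2 * q x y)) *\<^sub>R y"]
        by simp
    qed
    then show ?thesis by (simp add: q_pos)
  next
    case False
    then have pos: "0 < q y y" using q_pos[of y] by simp
    \<comment> \<open>The tested vector is the residual of projecting \<open>x\<close> onto
      \<open>y\<close>, scaled by \<open>q y y\<close> to avoid division.\<close>
    have "0 \<le> q y y * (q x x * q y y - (q x y)\<^sup>2)"
      using q_pos[of "q y y *\<^sub>R x + (- q x y) *\<^sub>R y"] unfolding expand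
      by (simp add: power2_eq_square algebra_simps)
    then show ?thesis using pos by (simp add: zero_le_mult_iff)
  qed
qed

section \<open>Operators, adjoints and contractions\<close>

lemma bop_add: "bop_apply T (x + y) = bop_apply T x + bop_apply T y"
  and bop_scaleR: "bop_apply T (r *\<^sub>R x) = r *\<^sub>R bop_apply T x"
  and bop_bounded_linear: "bounded_linear (bop_apply T)"
proof -
  show b: "bounded_linear (bop_apply T)"
    using bop_apply[of T] by (simp add: bounded_clinear_def)
  interpret bounded_linear "bop_apply T" by (rule b)
  show "bop_apply T (x + y) = bop_apply T x + bop_apply T y" by (rule add)
  show "bop_apply T (r *\<^sub>R x) = r *\<^sub>R bop_apply T x" by (rule scaleR)
qed

lemma bop_mult: "bop_apply (S * T) x = bop_apply S (bop_apply T x)"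
  by (simp add: times_bop.rep_eq)

lemma bop_power: "bop_apply (T ^ n) = bop_apply T ^^ n"
  by (induction n) (simp_all add: one_bop.rep_eq times_bop.rep_eq fun_eq_iff)

lemma adj_eqI:
  assumes "\<And>x y. cinner (bop_apply T x) y = cinner x (bop_apply S y)"
  shows "adj T = S"
  using ex_bop_adjoint[of T] assms cinner_adj[of T] by blast

lemma cinner_adj_left: "cinner (bop_apply (adj T) x) y = cinner x (bop_apply T y)"
  by (metis cinner_adj cinner_commute)

lemma adj_adj [simp]: "adj (adj T) = T"
  by (rule adj_eqI) (rule cinner_adj_left)

lemma adj_mult: "adj (S * T) = adj T * adj S"
  by (rule adj_eqI) (simp add: bop_mult cinner_adj)

lemma cinner_adj_power_left:
  "cinner (bop_apply (adj T ^ n) x) y = cinner x (bop_apply (T ^ n) y)"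
proof (induction n arbitrary: y)
  case (Suc n)
  then show ?case
    by (simp only: power_Suc[of "adj T"] power_Suc2[of T] bop_mult cinner_adj_left)
qed (simp add: one_bop.rep_eq)

lemma inner_adj_left: "inner (bop_apply (adj T) x) y = inner x (bop_apply T y)"
  by (simp add: inner_Re_cinner cinner_adj_left)

lemma inner_adj: "inner (bop_apply T x) y = inner x (bop_apply (adj T) y)"
  by (simp add: inner_Re_cinner cinner_adj)

lemma contraction_iff: "contraction T \<longleftrightarrow> (\<forall>x. norm (bop_apply T x) \<le> norm x)"
proof
  assume c: "contraction T"
  show "\<forall>x. norm (bop_apply T x) \<le> norm x"
  proof
    fix x
    have "norm (bop_apply T x) \<le> onorm (bop_apply T) * norm x"
      by (rule onorm[OF bop_bounded_linear])
    also have "\<dots> \<le> 1 * norm x"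
      using c by (intro mult_right_mono) (auto simp: contraction_def)
    finally show "norm (bop_apply T x) \<le> norm x" by simp
  qed
qed (auto simp: contraction_def intro: onorm_bound)

lemma contraction_adj:
  assumes "contraction T"
  shows "contraction (adj T)"
  unfolding contraction_iff
proof
  fix x
  let ?y = "bop_apply (adj T) x"
  have "norm ?y * norm ?y = inner x (bop_apply T ?y)"
    by (metis inner_adj_left power2_eq_square power2_norm_eq_inner)
  also have "\<dots> \<le> norm x * norm (bop_apply T ?y)" by (rule norm_cauchy_schwarz)
  also have "\<dots> \<le> norm x * norm ?y"
    using assms by (intro mult_left_mono) (auto simp: contraction_iff)
  finally show "norm ?y \<le> norm x"
    by (cases "?y = 0") auto
qed

section \<open>The form of the defect operator 1 - \<open>adj T * T\<close>\<close>

definition defect_form :: "'a::complex_inner bop \<Rightarrow> 'a \<Rightarrow> 'a \<Rightarrow> real" where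
  "defect_form T x y = inner x y - inner (bop_apply T x) (bop_apply T y)"

lemma defect_form_add: "defect_form T (x + y) z = defect_form T x z + defect_form T y z"
  and defect_form_scaleR: "defect_form T (r *\<^sub>R x) y = r * defect_form T x y"
  and defect_form_sym: "defect_form T x y = defect_form T y x"
  by (simp_all add: defect_form_def bop_add bop_scaleR inner_add_left inner_commute algebra_simps)

lemma defect_form_nonneg:
  assumes "contraction T"
  shows "0 \<le> defect_form T x x"
proof -
  have "(norm (bop_apply T x))\<^sup>2 \<le> (norm x)\<^sup>2"
    using assms by (intro power_mono) (auto simp: contraction_iff)
  then show ?thesis by (simp add: defect_form_def power2_norm_eq_inner)
qed

text \<open>The left side is \<open>?q x (?C x)\<close>, so by Cauchy-Schwarz it suffices that
  \<open>?C\<close> does not increase \<open>?q\<close>. This follows from log-convexity along the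
  bounded orbit of \<open>x\<close> under \<open>?C\<close>.\<close>

lemma defect_form_doubly_commuting_le:
  fixes T1 T2 :: "'a::chilbert_space bop"
  assumes dc: "doubly_commuting T1 T2" and c1: "contraction T1" and c2: "contraction T2"
  shows "defect_form T1 (bop_apply T2 x) (bop_apply T2 x) \<le> defect_form T1 x x"
proof -
  let ?q = "defect_form T1" and ?C = "bop_apply (adj T2 * T2)"
  have "T1 * T2 = T2 * T1" "adj (adj T1 * T2) = adj (T2 * adj T1)"
    using dc by (auto simp: doubly_commuting_def)
  then have comm: "T1 * T2 = T2 * T1" "adj T2 * T1 = T1 * adj T2"
    by (simp_all add: adj_mult)
  have comm1: "bop_apply T1 (bop_apply T2 v) = bop_apply T2 (bop_apply T1 v)"
    and comm2: "bop_apply (adj T2) (bop_apply T1 v) = bop_apply T1 (bop_apply (adj T2) v)" for v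
    by (metis bop_mult comm(1), metis bop_mult comm(2))
  \<comment> \<open>\<open>T2\<close> and \<open>adj T2\<close> are adjoint for \<open>?q\<close>
    too, because \<open>T1\<close> commutes with both.\<close>
  have shift: "?q (bop_apply T2 u) v = ?q u (bop_apply (adj T2) v)" for u v
    by (simp add: defect_form_def comm1 inner_adj comm2)
  then have shift': "?q (bop_apply (adj T2) u) v = ?q u (bop_apply T2 v)" for u v
    by (metis defect_form_sym)
  have q_CS: "(?q u v)\<^sup>2 \<le> ?q u u * ?q v v" for u v
    by (intro form_Cauchy_Schwarz defect_form_add defect_form_scaleR defect_form_nonneg c1)
      (rule defect_form_sym)
  define a where "a n = ?q ((?C ^^ n) x) ((?C ^^ n) x)" for n
  have "a 1 \<le> a 0"
  proof (rule bounded_log_convex_le)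
    show "0 \<le> a n" for n by (simp add: a_def defect_form_nonneg c1)
    show "(a (Suc n))\<^sup>2 \<le> a n * a (Suc (Suc n))" for n
    proof -
      \<comment> \<open>One factor \<open>?C\<close> moves from the left argument to the right,
        which prepares Cauchy-Schwarz.\<close>
      have "a (Suc n) = ?q ((?C ^^ n) x) ((?C ^^ Suc (Suc n)) x)"
        by (simp add: a_def bop_mult shift shift')
      then show ?thesis using q_CS by (simp add: a_def)
    qed
    show "a n \<le> (norm x)\<^sup>2" for n
    proof -
      have "norm ((?C ^^ n) x) \<le> norm x"
      proof (induction n)
        case (Suc n)
        then show ?case
          using c2 contraction_adj[OF c2] unfolding contraction_iff
          by (simp add: bop_mult) (meson order_trans)
      qed simp
      then have "(norm ((?C ^^ n) x))\<^sup>2 \<le> (norm x)\<^sup>2" by (intro power_mono) auto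
      moreover have "a n \<le> (norm ((?C ^^ n) x))\<^sup>2"
        by (simp add: a_def defect_form_def power2_norm_eq_inner)
      ultimately show ?thesis by linarith
    qed
  qed
  then have C_le: "?q (?C x) (?C x) \<le> ?q x x" by (simp add: a_def)
  have pos: "0 \<le> ?q x x" by (simp add: defect_form_nonneg c1)
  have eq: "?q (bop_apply T2 x) (bop_apply T2 x) = ?q x (?C x)"
    by (simp add: shift bop_mult)
  have "(?q x (?C x))\<^sup>2 \<le> ?q x x * ?q (?C x) (?C x)" by (rule q_CS)
  also have "\<dots> \<le> (?q x x)\<^sup>2"
    using C_le pos by (simp add: power2_eq_square mult_left_mono)
  finally show ?thesis unfolding eq using pos by (rule power2_le_imp_le)
qed

section \<open>The kernel of \<open>pair_map\<close>\<close>

text \<open>The four cases merge once adjoint powers move to the right argument, since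
  \<open>nat m\<close> or \<open>nat (- m)\<close> is always 0.\<close>

lemma cinner_pair_map:
  fixes T1 T2 :: "'a::chilbert_space bop"
  assumes "T1 * T2 = T2 * T1"
  shows "cinner (bop_apply (pair_map T1 T2 (m, n)) x) y =
    cinner (bop_apply (T2 ^ nat n) (bop_apply (T1 ^ nat m) x))
      (bop_apply (T2 ^ nat (- n)) (bop_apply (T1 ^ nat (- m)) y))"
proof -
  have "T1 ^ i * T2 ^ j = T2 ^ j * T1 ^ i" for i j
    using assms by (metis power_commuting_commutes)
  then have comm:
    "bop_apply (T1 ^ i) (bop_apply (T2 ^ j) v) = bop_apply (T2 ^ j) (bop_apply (T1 ^ i) v)" for i j v
    by (metis bop_mult)
  show ?thesis
    by (auto simp: pair_map_def bop_mult one_bop.rep_eq cinner_adj_power_left comm)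
qed

lemma pair_map_uminus:
  fixes T1 T2 :: "'a::chilbert_space bop"
  assumes "T1 * T2 = T2 * T1"
  shows "pair_map T1 T2 (- s) = adj (pair_map T1 T2 s)"
proof (rule adj_eqI[symmetric])
  obtain m n where s: "s = (m, n)" by (cases s)
  show "cinner (bop_apply (pair_map T1 T2 s) x) y =
      cinner x (bop_apply (pair_map T1 T2 (- s)) y)" for x y
    using cinner_pair_map[OF assms, of m n x y] cinner_pair_map[OF assms, of "-m" "-n" y x]
    by (metis cinner_commute minus_minus s uminus_Pair)
qed

lemma toeplitz_pair_nonneg:
  fixes T1 T2 :: "'a::chilbert_space bop" and h :: "nat \<Rightarrow> nat \<Rightarrow> 'a"
  assumes dc: "doubly_commuting T1 T2" and c1: "contraction T1" and c2: "contraction T2"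
  shows "0 \<le> (\<Sum>a<N. \<Sum>a'<N. \<Sum>b<N. \<Sum>b'<N.
    inner ((bop_apply T2 ^^ (b - b')) ((bop_apply T1 ^^ (a - a')) (h a b)))
      ((bop_apply T2 ^^ (b' - b)) ((bop_apply T1 ^^ (a' - a)) (h a' b'))))"
proof -
  let ?T1 = "bop_apply T1" and ?T2 = "bop_apply T2"
  have T2_add: "(?T2 ^^ n) (x + y) = (?T2 ^^ n) x + (?T2 ^^ n) y" for n x y
    by (simp add: bop_add flip: bop_power)
  have "?T1 (?T2 x) = ?T2 (?T1 x)" for x
    using dc by (metis bop_mult doubly_commuting_def)
  then have T2_comm: "?T1 ((?T2 ^^ n) x) = (?T2 ^^ n) (?T1 x)" for n x
    by (induction n) auto
  define q where "q x y = (\<Sum>b<N. \<Sum>b'<N. inner ((?T2 ^^ (b - b')) (x b)) ((?T2 ^^ (b' - b)) (y b')))"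
    for x y :: "nat \<Rightarrow> 'a"
  define T where "T x b = ?T1 (x b)" for x :: "nat \<Rightarrow> 'a" and b :: nat
  have T_pow: "(T ^^ n) x b = (?T1 ^^ n) (x b)" for n x b
    by (induction n) (simp_all add: T_def)
  have "0 \<le> (\<Sum>a<N. \<Sum>a'<N. q ((T ^^ (a - a')) (h a)) ((T ^^ (a' - a)) (h a')))"
  \<comment> \<open>Here the abelian group is \<open>nat \<Rightarrow> 'a\<close> with pointwise
    addition, and \<open>T\<close> applies \<open>T1\<close> to every entry.\<close>
  proof (rule toeplitz_form_nonneg[where q = q and T = T and x = h])
    show "q (x + y) z = q x z + q y z" for x y z
      by (simp add: q_def T2_add inner_add_left sum.distrib)
    show "q x y = q y x" for x y
      unfolding q_def by (subst sum.swap) (simp add: inner_commute)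
    show "T (x + y) = T x + T y" for x y
      by (simp add: T_def fun_eq_iff bop_add)
    show "0 \<le> q x x" for x
      unfolding q_def
      using defect_form_nonneg[OF c2]
      by (intro toeplitz_form_nonneg inner_add_left inner_commute bop_add)
        (auto simp: defect_form_def)
    show "q (T x) (T x) \<le> q x x" for x
    proof -
      \<comment> \<open>\<open>T1\<close> commutes with powers of \<open>T2\<close>, so the loss of
        \<open>q\<close> under \<open>T\<close> is the sum of \<open>T2\<close> for the defect form
        of \<open>T1\<close>, which \<open>T2\<close> contracts.\<close>
      have "0 \<le> (\<Sum>b<N. \<Sum>b'<N.
          defect_form T1 ((?T2 ^^ (b - b')) (x b)) ((?T2 ^^ (b' - b)) (x b')))"
        by (intro toeplitz_form_nonneg defect_form_add defect_form_nonneg c1 bop_add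
            defect_form_doubly_commuting_le dc c2) (rule defect_form_sym)
      also have "\<dots> = q x x - q (T x) (T x)"
        by (simp add: q_def T_def defect_form_def T2_comm sum_subtractf)
      finally show ?thesis by simp
    qed
  qed
  then show ?thesis by (simp add: q_def T_pow)
qed

section \<open>Sums over finite supports\<close>

lemma finite_int_pairs_subset_box:
  fixes F :: "(int \<times> int) set"
  assumes "finite F"
  obtains K N where "F \<subseteq> (\<lambda>(a, b). (int a - K, int b - K)) ` ({..<N} \<times> {..<N})"
proof -
  \<comment> \<open>Coordinates lie between \<open>-K\<close> and \<open>K\<close>; translation by
    \<open>K\<close> puts them in 0 to \<open>2 * K\<close>.\<close>
  define K where "K = (\<Sum>p\<in>F. \<bar>fst p\<bar> + \<bar>snd p\<bar>)"
  have "(a, b) \<in> (\<lambda>(a, b). (int a - K, int b - K)) ` ({..<nat (2 * K + 1)} \<times> {..<nat (2 * K + 1)})"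
    if "(a, b) \<in> F" for a b
  proof -
    have "\<bar>a\<bar> + \<bar>b\<bar> \<le> K"
      unfolding K_def using member_le_sum[of "(a, b)" F "\<lambda>p. \<bar>fst p\<bar> + \<bar>snd p\<bar>"] that assms by simp
    then show ?thesis
      by (intro image_eqI[of _ _ "(nat (a + K), nat (b + K))"]) auto
  qed
  then show thesis by (intro that[of K "nat (2 * K + 1)"]) auto
qed

lemma kernel_sum_superset:
  fixes T :: "'g::group_add \<Rightarrow> 'a::chilbert_space bop"
  assumes "finite A" "{s. h s \<noteq> 0} \<subseteq> A"
  shows "(\<Sum>s | h s \<noteq> 0. \<Sum>t | h t \<noteq> 0. cinner (bop_apply (T (- t + s)) (h s)) (h t)) =
    (\<Sum>s\<in>A. \<Sum>t\<in>A. cinner (bop_apply (T (- t + s)) (h s)) (h t))"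
proof -
  have zero_right: "cinner x 0 = 0" for x :: 'a
    using cinner_add_left[of 0 0 x] cinner_commute[of x 0] by simp
  have zero_left: "cinner (bop_apply S 0) x = 0" for S :: "'a bop" and x
    by (metis cinner_adj cinner_commute complex_cnj_zero zero_right)
  have "(\<Sum>t | h t \<noteq> 0. cinner (bop_apply (T (- t + s)) (h s)) (h t)) =
      (\<Sum>t\<in>A. cinner (bop_apply (T (- t + s)) (h s)) (h t))" for s
    using assms by (intro sum.mono_neutral_left) (auto simp: zero_right)
  then show ?thesis
    using assms by (simp, intro sum.mono_neutral_left) (auto simp: zero_left)
qed

text \<open>Conjugation swaps \<open>s\<close> and \<open>t\<close>, as \<open>- s + t\<close> is
  the inverse of \<open>- t + s\<close>; the double sum is thus self-conjugate.\<close>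

lemma kernel_sum_Im:
  fixes T :: "'g::group_add \<Rightarrow> 'a::chilbert_space bop"
  assumes "\<And>s. T (- s) = adj (T s)"
  shows "Im (\<Sum>s\<in>A. \<Sum>t\<in>A. cinner (bop_apply (T (- t + s)) (h s)) (h t)) = 0"
    (is "Im ?S = 0")
proof -
  have "cnj (cinner (bop_apply (T (- t + s)) (h s)) (h t)) =
      cinner (bop_apply (T (- s + t)) (h t)) (h s)" for s t
    using assms[of "- s + t"]
    by (metis add.inverse_inverse cinner_adj cinner_commute minus_add)
  then have "cnj ?S =
      (\<Sum>s\<in>A. \<Sum>t\<in>A. cinner (bop_apply (T (- s + t)) (h t)) (h s))"
    by simp
  also have "\<dots> = ?S"
    by (rule sum.swap)
  finally have "Im (cnj ?S) = Im ?S" by (rule arg_cong)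
  then show ?thesis unfolding cnj.sel by linarith
qed

section \<open>The two directions of the equivalence\<close>

lemma contraction_if_positive_definite:
  fixes T :: "'g::group_add \<Rightarrow> 'a::chilbert_space bop"
  assumes pd: "positive_definite T" and g: "g \<noteq> 0" and T0: "T 0 = 1"
  shows "contraction (T g)"
  unfolding contraction_iff
proof
  fix x
  let ?S = "bop_apply (T g)"
  \<comment> \<open>With \<open>x\<close> placed at \<open>g\<close>, the value
    \<open>- ?S x\<close> at 0 minimises the quadratic form.\<close>
  define h where "h s = (if s = g then x else if s = 0 then - ?S x else 0)" for s
  have supp: "{s. h s \<noteq> 0} \<subseteq> {0, g}" by (auto simp: h_def)
  then have "finite {s. h s \<noteq> 0}" by (rule finite_subset) simp
  with pd have "(\<Sum>s | h s \<noteq> 0. \<Sum>t | h t \<noteq> 0. cinner (bop_apply (T (- t + s)) (h s)) (h t)) \<in> \<real>\<^sub>\<ge>\<^sub>0"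
    by (simp add: positive_definite_def)
  then have "0 \<le> Re (\<Sum>s\<in>{0, g}. \<Sum>t\<in>{0, g}. cinner (bop_apply (T (- t + s)) (h s)) (h t))"
    by (simp add: kernel_sum_superset[OF _ supp] complex_nonneg_Reals_iff)
  also have "\<dots> = inner x x - inner (?S x) (?S x)"
  proof -
    have "T (- g) = adj (T g)" using pd by (simp add: positive_definite_def)
    then show ?thesis using g
      by (simp add: h_def T0 one_bop.rep_eq inner_adj_left flip: inner_Re_cinner)
  qed
  finally show "norm (?S x) \<le> norm x" by (simp add: norm_le)
qed

theorem proposition4p6:
  fixes T1 T2 :: "'a::chilbert_space bop"
  assumes "doubly_commuting T1 T2"
  shows "positive_definite (pair_map T1 T2) \<longleftrightarrow> contraction T1 \<and> contraction T2"
proof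
  assume pd: "positive_definite (pair_map T1 T2)"
  have "pair_map T1 T2 (1, 0) = T1" "pair_map T1 T2 (0, 1) = T2" "pair_map T1 T2 0 = 1"
    by (simp_all add: pair_map_def zero_prod_def)
  then show "contraction T1 \<and> contraction T2"
    using contraction_if_positive_definite[OF pd, of "(1, 0)"]
      contraction_if_positive_definite[OF pd, of "(0, 1)"]
    by (simp add: zero_prod_def)
next
  assume c: "contraction T1 \<and> contraction T2"
  have comm: "T1 * T2 = T2 * T1" using assms by (simp add: doubly_commuting_def)
  let ?k = "\<lambda>h s t. cinner (bop_apply (pair_map T1 T2 (- t + s)) (h s)) (h t)"
  show "positive_definite (pair_map T1 T2)"
    unfolding positive_definite_def
  proof (intro conjI allI impI)
    show "pair_map T1 T2 (- s) = adj (pair_map T1 T2 s)" for s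
      by (rule pair_map_uminus[OF comm])
    fix h :: "int \<times> int \<Rightarrow> 'a"
    assume "finite {s. h s \<noteq> 0}"
    then obtain K N where
      supp: "{s. h s \<noteq> 0} \<subseteq> (\<lambda>(a, b). (int a - K, int b - K)) ` ({..<N} \<times> {..<N})"
      by (rule finite_int_pairs_subset_box)
    define \<phi> where "\<phi> = (\<lambda>(a, b). (int a - K, int b - K))"
    define B where "B = {..<N} \<times> {..<N}"
    have inj: "inj_on \<phi> B" by (auto simp: inj_on_def \<phi>_def)
    \<comment> \<open>The shift \<open>K\<close> cancels in differences, and \<open>nat\<close> of
      an integer difference is truncated subtraction.\<close>
    have k: "Re (?k h (\<phi> (a, b)) (\<phi> (a', b'))) =
      inner ((bop_apply T2 ^^ (b - b')) ((bop_apply T1 ^^ (a - a')) (h (\<phi> (a, b)))))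
        ((bop_apply T2 ^^ (b' - b)) ((bop_apply T1 ^^ (a' - a)) (h (\<phi> (a', b')))))" for a b a' b'
      by (simp add: \<phi>_def cinner_pair_map[OF comm] bop_power inner_Re_cinner nat_diff_distrib'
          flip: of_nat_diff)
    have "Re (\<Sum>s\<in>\<phi> ` B. \<Sum>t\<in>\<phi> ` B. ?k h s t) =
        (\<Sum>a<N. \<Sum>b<N. \<Sum>a'<N. \<Sum>b'<N. Re (?k h (\<phi> (a, b)) (\<phi> (a', b'))))"
      unfolding sum.reindex[OF inj] comp_def
      unfolding B_def Re_sum sum.cartesian_product' ..
    \<comment> \<open>The two middle sums are exchanged to pair the indices of each
      operator.\<close>
    also have "\<dots> = (\<Sum>a<N. \<Sum>a'<N. \<Sum>b<N. \<Sum>b'<N. Re (?k h (\<phi> (a, b)) (\<phi> (a', b'))))"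
      by (intro sum.cong refl sum.swap)
    also have "0 \<le> \<dots>"
      unfolding k using toeplitz_pair_nonneg[OF assms, where N = N and h = "\<lambda>a b. h (\<phi> (a, b))"] c by simp
    finally have "0 \<le> Re (\<Sum>s\<in>\<phi> ` B. \<Sum>t\<in>\<phi> ` B. ?k h s t)" .
    moreover have "Im (\<Sum>s\<in>\<phi> ` B. \<Sum>t\<in>\<phi> ` B. ?k h s t) = 0"
      by (rule kernel_sum_Im) (rule pair_map_uminus[OF comm])
    moreover have "(\<Sum>s | h s \<noteq> 0. \<Sum>t | h t \<noteq> 0. ?k h s t) = (\<Sum>s\<in>\<phi> ` B. \<Sum>t\<in>\<phi> ` B. ?k h s t)"
      using supp by (intro kernel_sum_superset) (auto simp: \<phi>_def B_def)
    ultimately show "(\<Sum>s | h s \<noteq> 0. \<Sum>t | h t \<noteq> 0. ?k h s t) \<in> \<real>\<^sub>\<ge>\<^sub>0"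
      by (simp add: complex_nonneg_Reals_iff)
  qed
qed

end
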